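(* Let $n\ge 2$ be an integer. Let $\mathfrak A$ and $\mathfrak A'$ be prime $C^*$-algebras with identities $I_{\mathfrak A}$ and $I_{\mathfrak A'}$, respectively, and let $P_1$ and $P_2=I_{\mathfrak A}-P_1$ be nontrivial projections in $\mathfrak A$. Let $\varphi:\mathfrak A\to\mathfrak A'$ be a map (not assumed additive) that preserves complex scalar multiplication. Then $\varphi$ is a bijective unital multiplicative $*$-Lie $n$-map if and only if $\varphi$ is a $*$-isomorphism.
   Context: A $C^*$-algebra $\mathfrak A$ is prime if, for $A,B\in\mathfrak A$, $A\mathfrak A B=\{0\}$ implies $A=0$ or $B=0$. For elements $x,y$ of a $*$-algebra, $[x,y]_*=xy-yx^*$. The polynomials $p_{n_*}$ are defined by $p_{1_*}(x)=x$ and $p_{n_*}(x_1,\ldots,x_n)=[p_{(n-1)_*}(x_1,\ldots,x_{n-1}),x_n]_*$ for $n\ge 2$. A map $\varphi$ (not necessarily additive) is a multiplicative $*$-Lie $n$-map if $\varphi(p_{n_*}(x_1,\ldots,x_n))=p_{n_*}(\varphi(x_1),\ldots,\varphi(x_n))$ for all $x_1,\ldots,x_n$ in its domain. A projection is an element $P$ with $P^2=P=P^*$; nontrivial means different from $0$ and the identity. Unital means $\varphi(I_{\mathfrak A})=I_{\mathfrak A'}$. Preserving complex scalar multiplication means $\varphi(\lambda A)=\lambda\varphi(A)$ for all $\lambda\in\mathbb C$, $A\in\mathfrak A$. A $*$-isomorphism is a bijective complex-linear multiplicative map preserving $*$. *)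

theory Defs
  imports Complex_Main
begin

text \<open>
  Complex C*-algebras, possibly without identity. The real scalar multiplication, norm and
  completeness come from the library classes and are tied to the complex structure by
  \<open>scaleR_scaleC\<close>.
\<close>

class cstar_algebra = banach + real_normed_algebra +
  fixes scaleC :: "complex \<Rightarrow> 'a \<Rightarrow> 'a"  (infixr \<open>*\<^sub>C\<close> 75)
    and adj :: "'a \<Rightarrow> 'a"
  assumes scaleC_add_right: "a *\<^sub>C (x + y) = a *\<^sub>C x + a *\<^sub>C y"
    and scaleC_add_left: "(a + b) *\<^sub>C x = a *\<^sub>C x + b *\<^sub>C x"
    and scaleC_scaleC: "a *\<^sub>C (b *\<^sub>C x) = (a * b) *\<^sub>C x"
    and scaleC_one: "1 *\<^sub>C x = x"
    and scaleR_scaleC: "r *\<^sub>R x = complex_of_real r *\<^sub>C x"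
    and norm_scaleC: "norm (a *\<^sub>C x) = cmod a * norm x"
    and mult_scaleC_left: "(a *\<^sub>C x) * y = a *\<^sub>C (x * y)"
    and mult_scaleC_right: "x * (a *\<^sub>C y) = a *\<^sub>C (x * y)"
    and adj_adj: "adj (adj x) = x"
    and adj_add: "adj (x + y) = adj x + adj y"
    and adj_scaleC: "adj (a *\<^sub>C x) = cnj a *\<^sub>C adj x"
    and adj_mult: "adj (x * y) = adj y * adj x"
    and cstar_identity: "norm (adj x * x) = (norm x)\<^sup>2"

text \<open>
  The class \<open>monoid_mult\<close> rather than \<open>ring_1\<close> supplies the identity, so that the zero algebra
  is not excluded.
\<close>

class unital_cstar_algebra = cstar_algebra + monoid_mult

definition prime_algebra :: "'a::cstar_algebra itself \<Rightarrow> bool" where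
  "prime_algebra _ \<longleftrightarrow>
     (\<forall>A B :: 'a. {A * X * B | X. True} = {0} \<longrightarrow> A = 0 \<or> B = 0)"

definition projection :: "'a::cstar_algebra \<Rightarrow> bool" where
  "projection P \<longleftrightarrow> P * P = P \<and> adj P = P"

definition nontrivial_projection :: "'a::unital_cstar_algebra \<Rightarrow> bool" where
  "nontrivial_projection P \<longleftrightarrow> projection P \<and> P \<noteq> 0 \<and> P \<noteq> 1"

definition star_commutator :: "'a::cstar_algebra \<Rightarrow> 'a \<Rightarrow> 'a" where
  "star_commutator x y = x * y - y * adj x"

text \<open>
  The arguments of \<open>p_star n\<close> are the values \<open>x 1, \<dots>, x n\<close> of a sequence; its other values
  play no role. The value at \<open>n = 0\<close> is a dummy.
\<close>

fun p_star :: "nat \<Rightarrow> (nat \<Rightarrow> 'a::cstar_algebra) \<Rightarrow> 'a" where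
  "p_star 0 x = 0"
| "p_star (Suc 0) x = x 1"
| "p_star (Suc (Suc m)) x = star_commutator (p_star (Suc m) x) (x (Suc (Suc m)))"

definition multiplicative_star_Lie_map ::
    "nat \<Rightarrow> ('a::cstar_algebra \<Rightarrow> 'b::cstar_algebra) \<Rightarrow> bool" where
  "multiplicative_star_Lie_map n \<phi> \<longleftrightarrow>
     (\<forall>x :: nat \<Rightarrow> 'a. \<phi> (p_star n x) = p_star n (\<lambda>i. \<phi> (x i)))"

definition star_isomorphism :: "('a::cstar_algebra \<Rightarrow> 'b::cstar_algebra) \<Rightarrow> bool" where
  "star_isomorphism \<phi> \<longleftrightarrow>
     bij \<phi> \<and>
     Vector_Spaces.linear scaleC scaleC \<phi> \<and>
     (\<forall>A B. \<phi> (A * B) = \<phi> A * \<phi> B) \<and>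
     (\<forall>A. \<phi> (adj A) = adj (\<phi> A))"

end

theory Submission
  imports Defs
begin

text \<open>
  The identity for any arity \<open>n\<close> contains the one for two variables. Fill all but the last two places
  with \<open>\<i>1, 1, \<dots>, 1\<close>: an imaginary scalar \<open>c\<close> satisfies
  \<open>[c, A]\<^sub>* = 2cA\<close> and \<open>[cA, B]\<^sub>* = c(AB + BA\<^sup>*)\<close>, so \<open>p\<^sub>n\<close> collapses to a nonzero multiple
  of \<open>AB + BA\<^sup>*\<close>. Since \<open>\<phi>\<close> carries \<open>c1\<close> to \<open>c1\<close>, it respects the product
  \<open>(A, B) \<mapsto> AB + BA\<^sup>*\<close> (\<open>jordan_star_map_of_multiplicative_star_Lie_map\<close>) and, replacing \<open>A\<close> by
  \<open>\<i>A\<close>, also \<open>AB - BA\<^sup>*\<close>. Taking \<open>B = 1\<close> shows that \<open>\<phi>\<close> commutes with the involution.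

  These two products have sum \<open>2AB\<close>, so an additive \<open>\<phi>\<close> is multiplicative (\<open>mult\<close>), and the whole
  problem is additivity. Here the nontrivial projection enters. Let \<open>P\<close> be one, with
  \<open>Q = \<phi> P\<close>; then \<open>Q\<close> is a projection and \<open>\<phi>(1 - P) = 1 - Q\<close>. An off-diagonal Peirce
  corner is visible to the two products without any addition, which gives
  \<open>\<phi>(PA(1 - P)) = Q \<phi>(A) (1 - Q)\<close> (\<open>off_diagonal_corner\<close>), and \<open>\<phi>\<close> respects left
  multiplication of an off-diagonal \<open>X\<close> by a corner: \<open>\<phi>(PAX) = Q \<phi>(A) \<phi>(X)\<close>
  (\<open>off_diagonal_mult_right\<close>). Because the images \<open>\<phi>(X)\<close> exhaust the off-diagonal corner of the
  prime target algebra, they separate the elements of its diagonal corner (\<open>corner_eq_zeroI\<close>).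

  For off-diagonal \<open>A\<close> and \<open>B\<close>, the corner of the twisted product of \<open>P + A\<close> and \<open>1 - P + B\<close> is
  \<open>A + B\<close>. This writes a sum as a product and makes \<open>\<phi>\<close> additive off the diagonal
  (\<open>off_diagonal_corner_add\<close>). Multiplying by off-diagonal elements transports additivity to the
  diagonal corners, and the four corners together determine an element.
\<close>


section \<open>Elementary rules for complex star algebras\<close>

interpretation scaleC: vector_space "scaleC :: complex \<Rightarrow> 'a::cstar_algebra \<Rightarrow> 'a"
  by unfold_locales (simp_all add: scaleC_add_right scaleC_add_left scaleC_scaleC scaleC_one)

lemma adj_zero [simp]: "adj (0::'a::cstar_algebra) = 0"
  using adj_add[of "0::'a" 0] by simp

lemma adj_minus: "adj (- x) = - adj (x::'a::cstar_algebra)"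
  using adj_add[of x "- x"] by (simp add: eq_neg_iff_add_eq_0 add.commute)

lemma adj_diff: "adj (x - y) = adj x - adj (y::'a::cstar_algebra)"
  using adj_add[of x "- y"] by (simp add: adj_minus)

lemma adj_one [simp]: "adj (1::'a::unital_cstar_algebra) = 1"
  by (metis adj_adj adj_mult mult_1_left mult_1_right)

lemma double_cancel: "x + x = y + y \<longleftrightarrow> x = (y::'a::cstar_algebra)"
  by (metis scaleR_2 scaleR_cancel_left zero_neq_numeral)

lemmas star_simps = algebra_simps adj_add adj_minus adj_diff adj_mult adj_scaleC adj_adj
  mult_scaleC_left mult_scaleC_right

lemma projection_idem: "projection P \<Longrightarrow> P * P = P"
  and projection_adj: "projection P \<Longrightarrow> adj P = P"
  by (simp_all add: projection_def)

lemma projection_absorb: "projection P \<Longrightarrow> P * (P * x) = P * x"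
  by (simp add: projection_def flip: mult.assoc)

lemmas projection_simps = projection_idem projection_adj projection_absorb

lemma projection_compl:
  "projection P \<Longrightarrow> projection (1 - P)" for P :: "'a::unital_cstar_algebra"
  by (simp add: projection_def star_simps)

lemma off_diagonalD:
  fixes P X :: "'a::unital_cstar_algebra"
  assumes P: "projection P" and X: "P * X * (1 - P) = X"
  shows "P * X = X" and "X * P = 0" and "P * adj X = 0" and "adj X * P = adj X"
proof -
  show PX: "P * X = X"
    using arg_cong[OF X, of "\<lambda>y. P * y"] X P by (simp add: projection_simps mult.assoc)
  show XP: "X * P = 0"
    using arg_cong[OF X, of "\<lambda>y. y * P"] P by (simp add: projection_simps algebra_simps)
  show "adj X * P = adj X" using arg_cong[OF PX, of adj] P by (simp add: adj_mult projection_adj)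
  show "P * adj X = 0" using arg_cong[OF XP, of adj] P by (simp add: adj_mult projection_adj)
qed

text \<open>
  The four corners of an element with respect to \<open>P\<close> add up to the element.
\<close>

lemma corner_ext:
  fixes P A B :: "'a::unital_cstar_algebra"
  assumes "P * A * P = P * B * P" and "P * A * (1 - P) = P * B * (1 - P)"
    and "(1 - P) * A * P = (1 - P) * B * P" and "(1 - P) * A * (1 - P) = (1 - P) * B * (1 - P)"
  shows "A = B"
proof -
  have "C = P * C * P + P * C * (1 - P) + (1 - P) * C * P + (1 - P) * C * (1 - P)" for C
    by (simp add: algebra_simps)
  from this[of A] this[of B] show ?thesis using assms by simp
qed

lemma prime_algebra_cancel:
  fixes A B :: "'a::cstar_algebra"
  assumes "prime_algebra TYPE('a)" and "\<And>X. A * X * B = 0" and "B \<noteq> 0"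
  shows "A = 0"
proof -
  have "{A * X * B | X. True} = {0}" using assms(2) by auto
  then show ?thesis using assms(1,3) unfolding prime_algebra_def by blast
qed

text \<open>
  The bracket of an imaginary scalar \<open>c\<close> with \<open>1\<close> is \<open>c - cnj c = 2c\<close>. A leading
  \<open>\<i>\<close> followed by ones is thus a way to pad \<open>p_star\<close> without changing it beyond a factor.
\<close>

lemma p_star_imaginary_unit:
  fixes x :: "nat \<Rightarrow> 'a::unital_cstar_algebra"
  assumes "x 1 = \<i> *\<^sub>C 1" and "\<And>j. 1 < j \<Longrightarrow> j \<le> Suc k \<Longrightarrow> x j = 1"
  shows "p_star (Suc k) x = (2 ^ k * \<i>) *\<^sub>C 1"
  using assms(2)
proof (induction k)
  case 0
  then show ?case using assms(1) by simp
next
  case (Suc k)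
  have "p_star (Suc k) x = (2 ^ k * \<i>) *\<^sub>C 1" using Suc by auto
  moreover have "x (Suc (Suc k)) = 1" using Suc.prems by auto
  ultimately show ?case
    by (simp add: star_commutator_def star_simps flip: scaleC_add_left)
qed

lemma star_commutator_imaginary:
  fixes A B :: "'a::unital_cstar_algebra"
  assumes "cnj c = - c"
  shows "star_commutator (c *\<^sub>C A) B = c *\<^sub>C (A * B + B * adj A)"
  using assms by (simp add: star_commutator_def star_simps)

lemma star_commutator_imaginary_scalar:
  fixes A B :: "'a::unital_cstar_algebra"
  assumes "cnj c = - c"
  shows "star_commutator (star_commutator (c *\<^sub>C 1) A) B = (2 * c) *\<^sub>C (A * B + B * adj A)"
proof -
  have "star_commutator (c *\<^sub>C 1) A = (2 * c) *\<^sub>C A"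
    using assms by (simp add: star_commutator_def star_simps flip: scaleC_add_left)
  moreover have "cnj (2 * c) = - (2 * c)" using assms by simp
  ultimately show ?thesis by (simp only: star_commutator_imaginary)
qed


section \<open>Unital bijections that respect the twisted Jordan product\<close>

locale jordan_star_map =
  fixes \<phi> :: "'a::unital_cstar_algebra \<Rightarrow> 'b::unital_cstar_algebra"
  assumes bij: "bij \<phi>"
    and one: "\<phi> 1 = 1"
    and scaleC: "\<phi> (c *\<^sub>C A) = c *\<^sub>C \<phi> A"
    and jordan: "\<phi> (A * B + B * adj A) = \<phi> A * \<phi> B + \<phi> B * adj (\<phi> A)"
begin

lemma zero: "\<phi> 0 = 0"
  using scaleC[of 0 0] by simp

lemma minus: "\<phi> (- A) = - \<phi> A"
  using scaleC[of "- 1" A] by simp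

lemma eq_zero_iff: "\<phi> A = 0 \<longleftrightarrow> A = 0"
  using bij zero by (metis bij_pointE)

text \<open>
  Replacing \<open>A\<close> by \<open>\<i>A\<close> turns the sign in \<open>jordan\<close>.
\<close>

lemma star_commutator: "\<phi> (A * B - B * adj A) = \<phi> A * \<phi> B - \<phi> B * adj (\<phi> A)"
proof -
  have "\<i> *\<^sub>C (A * B - B * adj A) = (\<i> *\<^sub>C A) * B + B * adj (\<i> *\<^sub>C A)"
    by (simp add: star_simps)
  then have "\<i> *\<^sub>C \<phi> (A * B - B * adj A) = \<phi> ((\<i> *\<^sub>C A) * B + B * adj (\<i> *\<^sub>C A))"
    by (simp only: scaleC[symmetric])
  also have "\<dots> = \<i> *\<^sub>C (\<phi> A * \<phi> B - \<phi> B * adj (\<phi> A))"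
    unfolding jordan scaleC by (simp add: star_simps)
  finally show ?thesis by simp
qed

text \<open>
  With \<open>B = 1\<close> the two products are \<open>A + A\<^sup>*\<close> and \<open>A - A\<^sup>*\<close>. Evaluating them at \<open>A\<^sup>*\<close> and
  adding in the target avoids any use of additivity of \<open>\<phi>\<close>.
\<close>

lemma adj: "\<phi> (adj A) = adj (\<phi> A)"
proof -
  have re: "\<phi> (adj A) + adj (\<phi> (adj A)) = \<phi> A + adj (\<phi> A)"
    using jordan[of "adj A" 1] jordan[of A 1] by (simp add: one adj_adj add.commute)
  have im: "\<phi> (adj A) - adj (\<phi> (adj A)) = - (\<phi> A - adj (\<phi> A))"
    using star_commutator[of "adj A" 1] star_commutator[of A 1] minus[of "A - adj A"]
    by (simp add: one adj_adj)
  have "\<phi> (adj A) + \<phi> (adj A)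
      = (\<phi> (adj A) + adj (\<phi> (adj A))) + (\<phi> (adj A) - adj (\<phi> (adj A)))" by simp
  also have "\<dots> = adj (\<phi> A) + adj (\<phi> A)" unfolding re im by simp
  finally show ?thesis by (simp add: double_cancel)
qed

lemma projection:
  assumes "projection P"
  shows "projection (\<phi> P)"
proof -
  have self: "adj (\<phi> P) = \<phi> P" using assms adj[of P] by (simp add: projection_adj)
  have "\<phi> P + \<phi> P = \<phi> (2 *\<^sub>C P)" using scaleC_add_left[of 1 1 "\<phi> P"] by (simp add: scaleC)
  also have "2 *\<^sub>C P = P * P + P * adj P"
    using assms scaleC_add_left[of 1 1 P] by (simp add: projection_simps)
  finally show ?thesis
    unfolding projection_def by (simp add: jordan self double_cancel)
qed

text \<open>
  The images \<open>Q\<close> and \<open>Q'\<close> of \<open>P\<close> and \<open>1 - P\<close> are orthogonal because \<open>P\<close> and \<open>1 - P\<close> have Jordan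
  product \<open>0\<close>. The preimage \<open>Z\<close> of the defect \<open>1 - Q - Q'\<close> then has Jordan product \<open>0\<close> with \<open>P\<close> and
  with \<open>1 - P\<close>, hence with \<open>1\<close>, which forces \<open>Z = 0\<close>.
\<close>

lemma projection_complement:
  assumes P: "projection P"
  shows "\<phi> (1 - P) = 1 - \<phi> P"
proof -
  let ?Q = "\<phi> P" and ?Q' = "\<phi> (1 - P)"
  note Q = projection[OF P] and P' = projection_compl[OF P]
  note Q' = projection[OF P']
  have anti: "?Q * ?Q' + ?Q' * ?Q = 0"
    using jordan[of P "1 - P"] P Q by (simp add: projection_simps zero algebra_simps)
  have "?Q * (?Q * ?Q' + ?Q' * ?Q) * ?Q = 0" by (simp add: anti)
  then have z: "?Q * ?Q' * ?Q = 0"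
    using Q double_cancel[of "?Q * ?Q' * ?Q" 0]
    by (simp add: projection_simps algebra_simps)
  have "?Q * (?Q * ?Q' + ?Q' * ?Q) = 0" by (simp add: anti)
  then have orth: "?Q * ?Q' = 0" using Q z by (simp add: projection_simps algebra_simps)
  with anti have orth': "?Q' * ?Q = 0" by simp
  obtain Z where Z: "\<phi> Z = 1 - ?Q - ?Q'" using bij by (metis bij_pointE)
  have "\<phi> (P * Z + Z * adj P) = 0"
    unfolding jordan Z by (use Q orth orth' in \<open>simp add: projection_simps algebra_simps\<close>)
  then have 1: "P * Z + Z * P = 0" using P by (simp add: eq_zero_iff projection_simps)
  have "\<phi> ((1 - P) * Z + Z * adj (1 - P)) = 0"
    unfolding jordan Z by (use Q' orth orth' in \<open>simp add: projection_simps algebra_simps\<close>)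
  then have 2: "(1 - P) * Z + Z * (1 - P) = 0" using P' by (simp add: eq_zero_iff projection_simps)
  have "Z + Z = 0 + 0" using 1 2 by (simp add: algebra_simps)
  then have "Z = 0" by (simp only: double_cancel)
  then show ?thesis using Z zero by (simp add: algebra_simps)
qed

text \<open>
  The twisted product of \<open>A\<close> with \<open>1 - P\<close>, commuted with \<open>P\<close>, equals \<open>X - X\<^sup>*\<close> for the corner
  \<open>X = PA(1 - P)\<close>, so that \<open>\<phi>(X - X\<^sup>*)\<close> is known. To separate \<open>X\<close> from \<open>X\<^sup>*\<close> without
  additivity, the formula is also applied to \<open>X\<close> itself, whose image is off-diagonal
  since \<open>[P, X] = X\<close> is preserved.
\<close>

lemma off_diagonal_corner:
  assumes P: "projection P"
  shows "\<phi> (P * A * (1 - P)) = \<phi> P * \<phi> A * (1 - \<phi> P)"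
proof -
  let ?Q = "\<phi> P"
  note Q = projection[OF P]
  have skew: "\<phi> (P * A * (1 - P) - (1 - P) * adj A * P)
      = ?Q * \<phi> A * (1 - ?Q) - (1 - ?Q) * adj (\<phi> A) * ?Q" for A
  proof -
    let ?S = "A * (1 - P) + (1 - P) * adj A"
    have S: "\<phi> ?S = \<phi> A * (1 - ?Q) + (1 - ?Q) * adj (\<phi> A)"
      using jordan[of A "1 - P"] by (simp add: projection_complement P)
    have "P * A * (1 - P) - (1 - P) * adj A * P = P * ?S - ?S * adj P"
      using P by (simp add: projection_simps algebra_simps)
    then have "\<phi> (P * A * (1 - P) - (1 - P) * adj A * P) = ?Q * \<phi> ?S - \<phi> ?S * adj ?Q"
      by (simp only: star_commutator)
    also have "\<dots> = ?Q * \<phi> A * (1 - ?Q) - (1 - ?Q) * adj (\<phi> A) * ?Q"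
      unfolding S using Q by (simp add: projection_simps algebra_simps)
    finally show ?thesis .
  qed
  let ?X = "P * A * (1 - P)"
  let ?Y = "\<phi> ?X"
  have "?X = P * ?X - ?X * adj P" using P by (simp add: projection_simps algebra_simps)
  then have eig: "?Y = ?Q * ?Y - ?Y * ?Q"
    using star_commutator[of P ?X] Q by (simp add: projection_simps)
  \<comment> \<open>The eigenvalue equation \<open>[Q, Y] = Y\<close> leaves only the corner \<open>QY(1 - Q)\<close>.\<close>
  have corner: "?Q * ?Y * (1 - ?Q) = ?Y"
  proof -
    have "?Y * ?Q = ?Q * ?Y * ?Q - ?Y * ?Q"
      using arg_cong[OF eig, of "\<lambda>y. y * ?Q"] Q by (simp add: projection_simps algebra_simps)
    moreover have "?Q * ?Y * ?Q = 0"
      using arg_cong[OF eig, of "\<lambda>y. ?Q * y"] Q by (simp add: projection_simps algebra_simps)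
    ultimately have "?Y * ?Q = 0" using double_cancel[of "?Y * ?Q" 0] by (simp add: eq_neg_iff_add_eq_0)
    then show ?thesis using eig by (simp add: algebra_simps)
  qed
  have "?Q * (?Q * ?Y * (1 - ?Q) - (1 - ?Q) * adj ?Y * ?Q)
      = ?Q * (?Q * \<phi> A * (1 - ?Q) - (1 - ?Q) * adj (\<phi> A) * ?Q)"
  proof -
    have "P * ?X * (1 - P) - (1 - P) * adj ?X * P = P * A * (1 - P) - (1 - P) * adj A * P"
      using P by (simp add: projection_simps star_simps)
    then show ?thesis using skew[of ?X] skew[of A] by simp
  qed
  \<comment> \<open>Left multiplication by \<open>Q\<close> kills the adjoint half of the skew expression.\<close>
  moreover have "?Q * (?Q * Z * (1 - ?Q) - (1 - ?Q) * adj Z * ?Q) = ?Q * Z * (1 - ?Q)" for Z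
    using Q by (simp add: projection_simps algebra_simps)
  ultimately have "?Q * ?Y * (1 - ?Q) = ?Q * \<phi> A * (1 - ?Q)" by metis
  then show ?thesis unfolding corner .
qed

text \<open>
  In the twisted product of \<open>X\<close> with \<open>A\<close> the summand \<open>AX\<^sup>*\<close> ends in \<open>P\<close>, so passing to the corner at
  \<open>(P, 1 - P)\<close> leaves only the ordinary product.
\<close>

lemma off_diagonal_mult_left:
  assumes P: "projection P" and X: "P * X * (1 - P) = X"
  shows "\<phi> (X * A * (1 - P)) = \<phi> X * \<phi> A * (1 - \<phi> P)"
proof -
  note Q = projection[OF P]
  have Y: "\<phi> P * \<phi> X * (1 - \<phi> P) = \<phi> X" using off_diagonal_corner[OF P, of X] X by simp
  \<comment> \<open>Stated for an arbitrary algebra, as it is used both for \<open>P\<close> and for its image.\<close>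
  have *: "R * (X * A + A * adj X) * (1 - R) = X * A * (1 - R)"
    if "projection R" "R * X * (1 - R) = X"
    for R X A :: "'c::unital_cstar_algebra"
  proof -
    note R = off_diagonalD[OF that]
    have "R * (A * adj X) * (1 - R) = 0"
      using R(4) by (simp add: right_diff_distrib mult.assoc)
    moreover have "R * (X * A) = X * A" using R(1) by (simp flip: mult.assoc)
    ultimately show ?thesis by (simp add: distrib_left distrib_right)
  qed
  show ?thesis
    using off_diagonal_corner[OF P, of "X * A + A * adj X"]
    unfolding jordan *[OF P X] *[OF Q Y] .
qed

text \<open>
  This is the adjoint of \<open>off_diagonal_mult_left\<close> for the complementary projection.
\<close>

lemma off_diagonal_mult_right:
  assumes P: "projection P" and X: "P * X * (1 - P) = X"
  shows "\<phi> (P * A * X) = \<phi> P * \<phi> A * \<phi> X"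
proof -
  have "(1 - P) * adj X * (1 - (1 - P)) = adj X"
    using arg_cong[OF X, of adj] P by (simp add: adj_mult adj_diff projection_simps mult.assoc)
  from off_diagonal_mult_left[OF projection_compl[OF P] this, of "adj A"]
  have mult_adj: "\<phi> (adj X * adj A * P) = \<phi> (adj X) * \<phi> (adj A) * \<phi> P"
    by (simp add: projection_complement P)
  have "\<phi> (P * A * X) = \<phi> (adj (adj X * adj A * P))"
    using P by (simp add: adj_mult adj_adj projection_adj mult.assoc)
  also have "\<dots> = adj (\<phi> (adj X) * \<phi> (adj A) * \<phi> P)"
    by (simp only: adj mult_adj)
  also have "\<dots> = \<phi> P * \<phi> A * \<phi> X"
    unfolding adj using projection[OF P] by (simp add: adj_mult adj_adj projection_adj mult.assoc)
  finally show ?thesis .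
qed

text \<open>
  Every element \<open>QZ(1 - Q)\<close> of the target is the image of an off-diagonal element, by surjectivity
  and \<open>off_diagonal_corner\<close>. If \<open>QC\<close> annihilates all of them, then \<open>QCQ Z (1 - Q) = 0\<close> for every
  \<open>Z\<close>, and primeness applies.
\<close>

lemma corner_eq_zeroI:
  assumes prime: "prime_algebra TYPE('b)" and P: "projection P" "P \<noteq> 1"
    and ann: "\<And>X. P * X * (1 - P) = X \<Longrightarrow> \<phi> P * C * \<phi> X = 0"
  shows "\<phi> P * C * \<phi> P = 0"
proof (rule prime_algebra_cancel[OF prime])
  show "1 - \<phi> P \<noteq> 0"
    using eq_zero_iff[of "1 - P"] P by (simp add: projection_complement)
  fix Z
  obtain X where X: "\<phi> X = Z" using bij by (metis bij_pointE)
  have "P * (P * X * (1 - P)) * (1 - P) = P * X * (1 - P)"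
    using P by (simp add: projection_simps algebra_simps)
  from ann[OF this] show "\<phi> P * C * \<phi> P * Z * (1 - \<phi> P) = 0"
    unfolding off_diagonal_corner[OF P(1)] X by (simp only: mult.assoc)
qed

text \<open>
  By \<open>off_diagonal_mult_right\<close>, the way \<open>Q \<phi>(A)\<close> acts on off-diagonal images depends on \<open>PAX\<close> only,
  and \<open>X = PX\<close>.
\<close>

lemma diagonal_corner_cong:
  assumes "prime_algebra TYPE('b)" and P: "projection P" "P \<noteq> 1"
    and eq: "P * A * P = P * B * P"
  shows "\<phi> P * \<phi> A * \<phi> P = \<phi> P * \<phi> B * \<phi> P"
proof -
  have "\<phi> P * (\<phi> A - \<phi> B) * \<phi> P = 0"
  proof (rule corner_eq_zeroI[OF assms(1) P])
    fix X assume X: "P * X * (1 - P) = X"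
    have "P * C * X = P * C * P * X" for C
      unfolding mult.assoc off_diagonalD(1)[OF P(1) X] ..
    then have "P * A * X = P * B * X" by (simp only: eq)
    then have "\<phi> P * \<phi> A * \<phi> X = \<phi> P * \<phi> B * \<phi> X"
      by (simp only: flip: off_diagonal_mult_right[OF P(1) X])
    then show "\<phi> P * (\<phi> A - \<phi> B) * \<phi> X = 0" by (simp add: left_diff_distrib right_diff_distrib)
  qed
  then show ?thesis by (simp add: left_diff_distrib right_diff_distrib)
qed

text \<open>
  The sum \<open>A + B\<close> is the \<open>(P, 1 - P)\<close> corner of the twisted product of \<open>P + A\<close> and \<open>1 - P + B\<close>. The
  images of these two factors are found corner by corner, and the same identity, read
  in the target, evaluates the image of the product.
\<close>

lemma off_diagonal_corner_add:
  assumes prime: "prime_algebra TYPE('b)" and P: "projection P" "P \<noteq> 0" "P \<noteq> 1"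
    and A: "P * A * (1 - P) = A" and B: "P * B * (1 - P) = B"
  shows "\<phi> (A + B) = \<phi> A + \<phi> B"
proof -
  let ?Q = "\<phi> P"
  note Q = projection[OF P(1)] and P' = projection_compl[OF P(1)]
  have ne: "1 - P \<noteq> 1" using P by simp
  note A' = off_diagonalD[OF P(1) A] and B' = off_diagonalD[OF P(1) B]
  have imgA: "?Q * \<phi> A * (1 - ?Q) = \<phi> A" and imgB: "?Q * \<phi> B * (1 - ?Q) = \<phi> B"
    using off_diagonal_corner[OF P(1), of A] off_diagonal_corner[OF P(1), of B] A B by simp_all
  note QA = off_diagonalD[OF Q imgA] and QB = off_diagonalD[OF Q imgB]
  note cong = diagonal_corner_cong[OF prime P(1,3)]
  note cong' = diagonal_corner_cong[OF prime P' ne]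
  have X: "\<phi> (P + A) = ?Q + \<phi> A"
  proof (rule corner_ext[of ?Q])
    show "?Q * \<phi> (P + A) * ?Q = ?Q * (?Q + \<phi> A) * ?Q"
      using cong[of "P + A" P] P A' Q QA by (simp add: projection_simps algebra_simps)
    show "?Q * \<phi> (P + A) * (1 - ?Q) = ?Q * (?Q + \<phi> A) * (1 - ?Q)"
      using off_diagonal_corner[OF P(1), of "P + A"] P A' Q QA
      by (simp add: projection_simps algebra_simps)
    show "(1 - ?Q) * \<phi> (P + A) * ?Q = (1 - ?Q) * (?Q + \<phi> A) * ?Q"
      using off_diagonal_corner[OF P', of "P + A"] P A' Q QA
      by (simp add: projection_complement zero projection_simps algebra_simps)
    show "(1 - ?Q) * \<phi> (P + A) * (1 - ?Q) = (1 - ?Q) * (?Q + \<phi> A) * (1 - ?Q)"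
      using cong'[of "P + A" 0] P A' Q QA
      by (simp add: projection_complement zero projection_simps algebra_simps)
  qed
  have Z: "\<phi> (1 - P + B) = 1 - ?Q + \<phi> B"
  proof (rule corner_ext[of ?Q])
    show "?Q * \<phi> (1 - P + B) * ?Q = ?Q * (1 - ?Q + \<phi> B) * ?Q"
      using cong[of "1 - P + B" 0] P B' Q QB by (simp add: zero projection_simps algebra_simps)
    show "?Q * \<phi> (1 - P + B) * (1 - ?Q) = ?Q * (1 - ?Q + \<phi> B) * (1 - ?Q)"
      using off_diagonal_corner[OF P(1), of "1 - P + B"] P B' Q QB
      by (simp add: projection_simps algebra_simps)
    show "(1 - ?Q) * \<phi> (1 - P + B) * ?Q = (1 - ?Q) * (1 - ?Q + \<phi> B) * ?Q"
      using off_diagonal_corner[OF P', of "1 - P + B"] P B' Q QB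
      by (simp add: projection_complement zero projection_simps algebra_simps)
    show "(1 - ?Q) * \<phi> (1 - P + B) * (1 - ?Q) = (1 - ?Q) * (1 - ?Q + \<phi> B) * (1 - ?Q)"
      using cong'[of "1 - P + B" "1 - P"] P B' Q QB
      by (simp add: projection_complement zero projection_simps algebra_simps)
  qed
  let ?T = "(P + A) * (1 - P + B) + (1 - P + B) * adj (P + A)"
  \<comment> \<open>Stated for an arbitrary algebra, as it is used both for \<open>P\<close> and for its image.\<close>
  have T: "R * ((R + C) * (1 - R + D) + (1 - R + D) * adj (R + C)) * (1 - R) = C + D"
    if "projection R" "R * C * (1 - R) = C" "R * D * (1 - R) = D"
    for R C D :: "'c::unital_cstar_algebra"
  proof -
    note C = off_diagonalD[OF that(1,2)] and D = off_diagonalD[OF that(1,3)]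
    have "C * D = C * R * D" unfolding mult.assoc D(1) ..
    then have "C * D = 0" by (simp add: C(2))
    then have left: "(R + C) * (1 - R + D) = C + D"
      using that(1) C(2) D(1) by (simp add: projection_idem algebra_simps)
    have right: "adj (R + C) * (1 - R) = 0"
      using that(1) C(4) by (simp add: projection_simps adj_add algebra_simps)
    have "R * (C + D + K) * (1 - R) = R * C * (1 - R) + R * D * (1 - R) + R * (K * (1 - R))" for K
      by (simp only: distrib_left distrib_right mult.assoc)
    then show ?thesis unfolding left that(2,3) by (simp only: mult.assoc right) simp
  qed
  have "\<phi> (A + B) = \<phi> (P * ?T * (1 - P))" by (rule arg_cong[OF T[OF P(1) A B, symmetric]])
  also have "\<dots> = ?Q * \<phi> ?T * (1 - ?Q)" by (rule off_diagonal_corner[OF P(1)])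
  also have "\<dots> = \<phi> A + \<phi> B" unfolding jordan X Z by (rule T[OF Q imgA imgB])
  finally show ?thesis .
qed

text \<open>
  For off-diagonal \<open>X\<close> both \<open>PAX\<close> and \<open>PBX\<close> are off-diagonal, where additivity is known.
\<close>

lemma diagonal_corner_add:
  assumes prime: "prime_algebra TYPE('b)" and P: "projection P" "P \<noteq> 0" "P \<noteq> 1"
  shows "\<phi> P * \<phi> (A + B) * \<phi> P = \<phi> P * (\<phi> A + \<phi> B) * \<phi> P"
proof -
  have "\<phi> P * (\<phi> (A + B) - (\<phi> A + \<phi> B)) * \<phi> P = 0"
  proof (rule corner_eq_zeroI[OF prime P(1,3)])
    fix X assume X: "P * X * (1 - P) = X"
    note X' = off_diagonalD[OF P(1) X]
    have off: "P * (P * C * X) * (1 - P) = P * C * X" for C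
      using P X' by (simp add: projection_simps algebra_simps)
    have "\<phi> (P * (A + B) * X) = \<phi> (P * A * X + P * B * X)" by (simp add: algebra_simps)
    also have "\<dots> = \<phi> (P * A * X) + \<phi> (P * B * X)"
      by (rule off_diagonal_corner_add[OF prime P off off])
    finally show "\<phi> P * (\<phi> (A + B) - (\<phi> A + \<phi> B)) * \<phi> X = 0"
      unfolding off_diagonal_mult_right[OF P(1) X] by (simp add: algebra_simps)
  qed
  then show ?thesis by (simp add: left_diff_distrib right_diff_distrib)
qed

lemma off_diagonal_component_add:
  assumes prime: "prime_algebra TYPE('b)" and P: "projection P" "P \<noteq> 0" "P \<noteq> 1"
  shows "\<phi> P * \<phi> (A + B) * (1 - \<phi> P) = \<phi> P * (\<phi> A + \<phi> B) * (1 - \<phi> P)"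
proof -
  have off: "P * (P * C * (1 - P)) * (1 - P) = P * C * (1 - P)" for C
    using P by (simp add: projection_simps algebra_simps)
  have "\<phi> (P * (A + B) * (1 - P)) = \<phi> (P * A * (1 - P) + P * B * (1 - P))"
    by (simp add: distrib_left distrib_right)
  also have "\<dots> = \<phi> (P * A * (1 - P)) + \<phi> (P * B * (1 - P))"
    by (rule off_diagonal_corner_add[OF prime P off off])
  finally show ?thesis
    unfolding off_diagonal_corner[OF P(1)] by (simp only: distrib_left distrib_right)
qed

lemma add:
  fixes P :: 'a
  assumes prime: "prime_algebra TYPE('b)" and P: "projection P" "P \<noteq> 0" "P \<noteq> 1"
  shows "\<phi> (A + B) = \<phi> A + \<phi> B"
proof -
  have P': "projection (1 - P)" "1 - P \<noteq> 0" "1 - P \<noteq> 1"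
    using P by (simp_all add: projection_compl)
  have compl: "\<phi> (1 - P) = 1 - \<phi> P" "1 - (1 - \<phi> P) = \<phi> P"
    by (simp_all add: projection_complement P)
  show ?thesis
    by (rule corner_ext[OF diagonal_corner_add[OF prime P] off_diagonal_component_add[OF prime P]
          off_diagonal_component_add[OF prime P', unfolded compl]
          diagonal_corner_add[OF prime P', unfolded compl]])
qed

lemma mult:
  assumes add: "\<And>A B. \<phi> (A + B) = \<phi> A + \<phi> B"
  shows "\<phi> (A * B) = \<phi> A * \<phi> B"
proof -
  have "\<phi> (A * B) + \<phi> (A * B) = \<phi> (A * B + B * adj A) + \<phi> (A * B - B * adj A)"
    by (simp flip: add)
  also have "\<dots> = \<phi> A * \<phi> B + \<phi> A * \<phi> B" by (simp add: jordan star_commutator)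
  finally show ?thesis by (simp add: double_cancel)
qed

end


section \<open>Multiplicative star-Lie maps and star-isomorphisms\<close>

text \<open>
  For \<open>n \<ge> 3\<close> the arguments \<open>\<i>1, 1, \<dots>, 1, A, B\<close> reduce the polynomial to a multiple of \<open>AB + BA\<^sup>*\<close>.
  For \<open>n = 2\<close> there is no room for the leading scalar, and \<open>\<i>\<close> is absorbed into \<open>A\<close>.
\<close>

lemma jordan_star_map_of_multiplicative_star_Lie_map:
  fixes \<phi> :: "'a::unital_cstar_algebra \<Rightarrow> 'b::unital_cstar_algebra"
  assumes n: "n \<ge> 2" and bij: "bij \<phi>" and one: "\<phi> 1 = 1"
    and Lie: "multiplicative_star_Lie_map n \<phi>"
    and scale: "\<And>c A. \<phi> (c *\<^sub>C A) = c *\<^sub>C \<phi> A"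
  shows "jordan_star_map \<phi>"
proof
  fix A B
  obtain c where c: "c \<noteq> 0"
    "\<phi> (c *\<^sub>C (A * B + B * adj A)) = c *\<^sub>C (\<phi> A * \<phi> B + \<phi> B * adj (\<phi> A))"
  proof (cases "n = 2")
    case True
    define x :: "nat \<Rightarrow> 'a" where "x = (\<lambda>j. if j = 1 then \<i> *\<^sub>C A else B)"
    have "\<phi> (p_star n x) = p_star n (\<lambda>j. \<phi> (x j))"
      using Lie by (simp add: multiplicative_star_Lie_map_def)
    then show ?thesis
      using that[of \<i>] True
      by (simp add: numeral_2_eq_2 x_def scale star_commutator_imaginary)
  next
    case False
    then obtain k where k: "n = Suc (Suc (Suc k))"
      using n by (metis One_nat_def Suc_1 Suc_le_D not_less_eq_eq le_antisym)
    define x :: "nat \<Rightarrow> 'a" where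
      "x = (\<lambda>j. if j = 1 then \<i> *\<^sub>C 1 else if j = Suc (Suc k) then A
                else if j = Suc (Suc (Suc k)) then B else 1)"
    have AB: "x (Suc (Suc k)) = A" "x (Suc (Suc (Suc k))) = B" by (simp_all add: x_def)
    have imaginary: "cnj (2 ^ k * \<i>) = - (2 ^ k * \<i>)" by simp
    have p: "p_star (Suc k) x = (2 ^ k * \<i>) *\<^sub>C 1"
      by (rule p_star_imaginary_unit) (auto simp: x_def)
    have q: "p_star (Suc k) (\<lambda>j. \<phi> (x j)) = (2 ^ k * \<i>) *\<^sub>C 1"
      by (rule p_star_imaginary_unit) (auto simp: x_def scale one)
    have "\<phi> (p_star n x) = p_star n (\<lambda>j. \<phi> (x j))"
      using Lie by (simp add: multiplicative_star_Lie_map_def)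
    then have "\<phi> ((2 * (2 ^ k * \<i>)) *\<^sub>C (A * B + B * adj A))
        = (2 * (2 ^ k * \<i>)) *\<^sub>C (\<phi> A * \<phi> B + \<phi> B * adj (\<phi> A))"
      unfolding k p_star.simps p q AB star_commutator_imaginary_scalar[OF imaginary] .
    then show ?thesis using that[of "2 * (2 ^ k * \<i>)"] by simp
  qed
  then show "\<phi> (A * B + B * adj A) = \<phi> A * \<phi> B + \<phi> B * adj (\<phi> A)"
    by (simp add: scale)
qed (use bij one scale in auto)

lemma star_isomorphism_imp_multiplicative_star_Lie_map:
  assumes "star_isomorphism \<phi>"
  shows "multiplicative_star_Lie_map n \<phi>"
proof -
  interpret Vector_Spaces.linear scaleC scaleC \<phi>
    using assms by (simp add: star_isomorphism_def)
  have "\<phi> (star_commutator A B) = star_commutator (\<phi> A) (\<phi> B)" for A B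
    using assms by (simp add: star_isomorphism_def star_commutator_def diff)
  then have "\<phi> (p_star n x) = p_star n (\<lambda>i. \<phi> (x i))" for x
    by (induction n x rule: p_star.induct) (simp_all add: zero)
  then show ?thesis by (simp add: multiplicative_star_Lie_map_def)
qed

text \<open>
  The element \<open>\<phi> 1\<close> is a left identity on the range of \<open>\<phi>\<close>, which contains \<open>1\<close>.
\<close>

lemma star_isomorphism_one:
  fixes \<phi> :: "'a::unital_cstar_algebra \<Rightarrow> 'b::unital_cstar_algebra"
  assumes "star_isomorphism \<phi>"
  shows "\<phi> 1 = 1"
proof -
  obtain E where "\<phi> E = 1" using assms unfolding star_isomorphism_def by (metis bij_pointE)
  moreover have "\<phi> (1 * E) = \<phi> 1 * \<phi> E" using assms unfolding star_isomorphism_def by blast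
  ultimately show ?thesis by simp
qed

theorem corollary3p2:
  fixes n :: nat
    and P1 P2 :: "'a::unital_cstar_algebra"
    and \<phi> :: "'a \<Rightarrow> 'b::unital_cstar_algebra"
  assumes "n \<ge> 2"
    and "prime_algebra TYPE('a)"
    and "prime_algebra TYPE('b)"
    and "nontrivial_projection P1"
    and "P2 = 1 - P1"
    and "nontrivial_projection P2"
    and "\<And>c A. \<phi> (c *\<^sub>C A) = c *\<^sub>C \<phi> A"
  shows "(bij \<phi> \<and> \<phi> 1 = 1 \<and> multiplicative_star_Lie_map n \<phi>) \<longleftrightarrow> star_isomorphism \<phi>"
proof
  assume "bij \<phi> \<and> \<phi> 1 = 1 \<and> multiplicative_star_Lie_map n \<phi>"
  then interpret jordan_star_map \<phi>
    using jordan_star_map_of_multiplicative_star_Lie_map assms(1,7) by blast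
  have add: "\<phi> (A + B) = \<phi> A + \<phi> B" for A B
    using add[OF assms(3), of P1] assms(4) by (simp add: nontrivial_projection_def)
  have "Vector_Spaces.linear scaleC scaleC \<phi>"
    by (simp add: Vector_Spaces.linear_iff add scaleC scaleC.vector_space_axioms)
  then show "star_isomorphism \<phi>"
    unfolding star_isomorphism_def using bij mult[OF add] adj by blast
next
  assume "star_isomorphism \<phi>"
  then show "bij \<phi> \<and> \<phi> 1 = 1 \<and> multiplicative_star_Lie_map n \<phi>"
    by (simp add: star_isomorphism_one star_isomorphism_imp_multiplicative_star_Lie_map)
      (simp add: star_isomorphism_def)
qed

end
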